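(* Let $T>0$, $0<\varepsilon<1$, $0\le \mu<1$, $\gamma>0$ with $\mu+\gamma\ge 1$, and $y_0\in\mathbb{R}$. Let $D=\{(t,s): 0\le s\le t\le T\}$, let $K_1,K_2\in C(D)$ and $p_1,q_1,g_1\in C[0,T]$. Consider the initial value problem $$y'(t)=p_1(t)y(t)+q_1(t)y(\varepsilon t)+g_1(t)+(\mathcal{K}_1y)(t)+(\mathcal{K}_2y)(t),\quad t\in[0,T],\qquad y(0)=y_0,$$ where $$(\mathcal{K}_1y)(t)=t^{-\gamma}\int_0^t(t-s)^{-\mu}s^{\mu+\gamma-1}K_1(t,s)y(s)\,ds,$$ $$(\mathcal{K}_2y)(t)=(\varepsilon t)^{-\gamma}\int_0^{\varepsilon t}(\varepsilon t-\tau)^{-\mu}\tau^{\mu+\gamma-1}K_2(t,\tau)y(\tau)\,d\tau.$$ Then this problem has a unique solution $y\in C^1[0,T]$. Furthermore, if $p_1,q_1,g_1\in C^m[0,T]$ and $K_1,K_2\in C^m(D)$ (where $m\ge 1$ is an integer), then the solution satisfies $y\in C^{m+1}[0,T]$.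
   Context: At $t=0$ the integral terms are understood through their continuous extension, i.e. $(\mathcal{K}_iy)(0)=B(1-\mu,\mu+\gamma)K_i(0,0)y(0)$, where $B$ is the Beta function (this is the value obtained from the substitution $s=t\xi$, respectively $\tau=\varepsilon t\xi$). *)

theory Defs
  imports "HOL-Analysis.Analysis"
begin

(* Class C^m on a (not necessarily open) set.  Derivatives are taken within S, so they are
   one-sided at boundary points; G is the gradient, its components the first partial derivatives.
   It is uniquely determined when S is convex with nonempty interior, as are the interval and the
   triangle below; for such S the definition says that all partial derivatives up to order m exist
   in the interior and extend continuously to S. *)
primrec Cm_on :: "nat \<Rightarrow> 'a::euclidean_space set \<Rightarrow> ('a \<Rightarrow> real) \<Rightarrow> bool" where
  "Cm_on 0 S f \<longleftrightarrow> continuous_on S f"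
| "Cm_on (Suc m) S f \<longleftrightarrow>
     (\<exists>G. (\<forall>x\<in>S. (f has_derivative (\<lambda>h. G x \<bullet> h)) (at x within S)) \<and>
          (\<forall>b\<in>Basis. Cm_on m S (\<lambda>x. G x \<bullet> b)))"

lemma Cm_on_Suc_real:
  fixes f :: "real \<Rightarrow> real"
  shows "Cm_on (Suc m) S f \<longleftrightarrow>
    (\<exists>f'. (\<forall>x\<in>S. (f has_real_derivative f' x) (at x within S)) \<and> Cm_on m S f')"
  by (simp add: has_field_derivative_def)

definition closed_triangle :: "real \<Rightarrow> (real \<times> real) set" where
  "closed_triangle T = {(t, s). 0 \<le> s \<and> s \<le> t \<and> t \<le> T}"

(* The value at t = 0 is the continuous extension.  The convention 0 powr 0 = 0 affects the
   integrands at no more than the two endpoints, so not the integrals. *)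
definition volterra_op ::
  "real \<Rightarrow> real \<Rightarrow> (real \<times> real \<Rightarrow> real) \<Rightarrow> (real \<Rightarrow> real) \<Rightarrow> real \<Rightarrow> real" where
  "volterra_op \<mu> \<gamma> K y t =
     (if t = 0 then Beta (1 - \<mu>) (\<mu> + \<gamma>) * K (0, 0) * y 0
      else t powr (- \<gamma>) *
        integral {0..t} (\<lambda>s. (t - s) powr (- \<mu>) * s powr (\<mu> + \<gamma> - 1) * K (t, s) * y s))"

definition delay_volterra_op ::
  "real \<Rightarrow> real \<Rightarrow> real \<Rightarrow> (real \<times> real \<Rightarrow> real) \<Rightarrow> (real \<Rightarrow> real) \<Rightarrow> real \<Rightarrow> real" where
  "delay_volterra_op \<epsilon> \<mu> \<gamma> K y t =
     (if t = 0 then Beta (1 - \<mu>) (\<mu> + \<gamma>) * K (0, 0) * y 0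
      else (\<epsilon> * t) powr (- \<gamma>) *
        integral {0..\<epsilon> * t}
          (\<lambda>\<tau>. (\<epsilon> * t - \<tau>) powr (- \<mu>) * \<tau> powr (\<mu> + \<gamma> - 1) * K (t, \<tau>) * y \<tau>))"

definition solves_ivp ::
  "real \<Rightarrow> real \<Rightarrow> real \<Rightarrow> real \<Rightarrow> (real \<Rightarrow> real) \<Rightarrow> (real \<Rightarrow> real) \<Rightarrow> (real \<Rightarrow> real) \<Rightarrow>
   (real \<times> real \<Rightarrow> real) \<Rightarrow> (real \<times> real \<Rightarrow> real) \<Rightarrow> real \<Rightarrow> (real \<Rightarrow> real) \<Rightarrow> bool" where
  "solves_ivp T \<epsilon> \<mu> \<gamma> p q g K1 K2 y0 y \<longleftrightarrow>
     y 0 = y0 \<and>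
     (\<forall>t\<in>{0..T}.
        (y has_real_derivative
           (p t * y t + q t * y (\<epsilon> * t) + g t
            + volterra_op \<mu> \<gamma> K1 y t + delay_volterra_op \<epsilon> \<mu> \<gamma> K2 y t))
        (at t within {0..T}))"

end

theory Submission
  imports Defs
begin

text \<open>Substituting \<open>s = t * x\<close> and \<open>\<tau> = \<epsilon> * t * x\<close> turns both kernel operators into
\<open>integral {0..1} (\<lambda>x. w x * (K (t, c * t * x) * y (c * t * x)))\<close> with the integrable weight
\<open>w x = (1 - x) powr (- \<mu>) * x powr (\<mu> + \<gamma> - 1)\<close> and \<open>c = 1\<close> or \<open>c = \<epsilon>\<close>; the singularity no longer
depends on \<open>t\<close>. The right-hand side is thus causal and Lipschitz in \<open>y\<close>, so that the Picard map is a
contraction for a supremum norm weighted by \<open>exp (- l * t)\<close> with large \<open>l\<close>. One can differentiate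
under the rescaled integral, so the right-hand side is of class \<open>C\<^sup>k\<close> whenever \<open>y\<close> and the data are, and
the equation lifts \<open>y\<close> from \<open>C\<^sup>k\<close> to \<open>C\<^sup>k\<^sup>+\<^sup>1\<close>.\<close>

section \<open>Causal Lipschitz right-hand sides\<close>

text \<open>The case \<open>M = 0\<close> of \<open>lip\<close> is causality: \<open>F y t\<close>
  is determined by the values of \<open>y\<close> on \<open>{0..t}\<close>. Stating the estimate for
  an arbitrary bound \<open>M\<close> covers both the delay and the integral terms without forming
  suprema.\<close>

locale causal_lipschitz =
  fixes T L :: real and F :: "(real \<Rightarrow> real) \<Rightarrow> real \<Rightarrow> real"
  assumes cont: "\<And>y. continuous_on {0..T} y \<Longrightarrow> continuous_on {0..T} (F y)"
    and lip: "\<And>y z t M. \<lbrakk>continuous_on {0..T} y; continuous_on {0..T} z; t \<in> {0..T};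
      \<And>s. s \<in> {0..t} \<Longrightarrow> \<bar>y s - z s\<bar> \<le> M\<rbrakk> \<Longrightarrow> \<bar>F y t - F z t\<bar> \<le> L * M"
    and L: "0 \<le> L"
begin

text \<open>By causality the Lipschitz estimate at \<open>s\<close> involves only points
  \<open>r \<le> s\<close>, where \<open>exp (l * r) \<le> exp (l * s)\<close>. The integrand is
  therefore at most \<open>L * M * exp (l * s)\<close>, and integrating the exponential gains the
  factor \<open>1 / l\<close>.\<close>

lemma weighted_integral_bound:
  assumes "0 < l" "0 \<le> M"
    and y: "continuous_on {0..T} y" and z: "continuous_on {0..T} z" and t: "t \<in> {0..T}"
    and bd: "\<And>s. s \<in> {0..T} \<Longrightarrow> \<bar>y s - z s\<bar> \<le> M * exp (l * s)"
  shows "\<bar>integral {0..t} (F y) - integral {0..t} (F z)\<bar> \<le> L / l * M * exp (l * t)"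
proof -
  have int: "F x integrable_on {0..t}" if "continuous_on {0..T} x" for x
    by (rule integrable_continuous_real) (rule continuous_on_subset[OF cont[OF that]], use t in auto)
  have E: "((\<lambda>s. L * M * exp (l * s)) has_integral
      (L * M * exp (l * t) / l - L * M * exp (l * 0) / l)) {0..t}"
    by (rule fundamental_theorem_of_calculus)
      (use t \<open>0 < l\<close> in \<open>auto intro!: derivative_eq_intros
        simp flip: has_real_derivative_iff_has_vector_derivative\<close>)
  have le: "norm (F y s - F z s) \<le> L * M * exp (l * s)" if s: "s \<in> {0..t}" for s
  proof -
    have "\<bar>y r - z r\<bar> \<le> M * exp (l * s)" if r: "r \<in> {0..s}" for r
    proof -
      have "\<bar>y r - z r\<bar> \<le> M * exp (l * r)" using bd[of r] r s t by auto
      also have "\<dots> \<le> M * exp (l * s)"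
        using r \<open>0 \<le> M\<close> \<open>0 < l\<close> by (intro mult_left_mono) auto
      finally show ?thesis .
    qed
    from lip[OF y z _ this] s t show ?thesis by (simp add: mult.assoc)
  qed
  have "norm (integral {0..t} (\<lambda>s. F y s - F z s)) \<le> integral {0..t} (\<lambda>s. L * M * exp (l * s))"
    by (rule integral_norm_bound_integral[OF _ _ le])
      (use E in \<open>auto intro!: integrable_diff int y z simp: has_integral_iff\<close>)
  also have "\<dots> = L / l * M * exp (l * t) - L / l * M"
    using integral_unique[OF E] by simp
  also have "\<dots> \<le> L / l * M * exp (l * t)"
    using L \<open>0 \<le> M\<close> \<open>0 < l\<close> by simp
  finally show ?thesis by (simp add: integral_diff int y z)
qed

text \<open>Solutions are the fixed points of the Picard map \<open>P\<close>, and the weight makes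
  \<open>P\<close> a contraction on the whole interval at once, so no step-by-step continuation is
  required. Existence comes from the Banach fixed point theorem, uniqueness from the same
  contraction estimate.\<close>

lemma unique_solution:
  assumes T: "0 < T"
  obtains y where "continuous_on {0..T} y" "y 0 = y0"
    "\<And>t. t \<in> {0..T} \<Longrightarrow> (y has_real_derivative F y t) (at t within {0..T})"
    "\<And>z t. \<lbrakk>continuous_on {0..T} z; z 0 = y0;
      \<And>t. t \<in> {0..T} \<Longrightarrow> (z has_real_derivative F z t) (at t within {0..T}); t \<in> {0..T}\<rbrakk>
      \<Longrightarrow> z t = y t"
proof -
  \<comment> \<open>This choice gives the contraction factor \<open>L / l \<le> 1/2\<close>, and the
    summand 1 keeps \<open>l\<close> positive when \<open>L = 0\<close>.\<close>
  define l where "l = 2 * L + 1"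
  have l: "0 < l" "L / l \<le> 1/2" using L by (auto simp: l_def field_simps)
  \<comment> \<open>The type of bounded continuous functions carries the unweighted supremum metric.
    Multiplying by \<open>exp (l * t)\<close> turns \<open>dist u v\<close> into the weighted
    distance of \<open>Y u\<close> and \<open>Y v\<close>.\<close>
  define Y where "Y u = (\<lambda>t. exp (l * t) * apply_bcontfun u t)" for u :: "real \<Rightarrow>\<^sub>C real"
  have Y: "continuous_on S (Y u)" for S u
    unfolding Y_def by (intro continuous_intros continuous_on_apply_bcontfun)
  define P where "P z t = y0 + integral {0..t} (F z)" for z t
  have P: "continuous_on {0..T} (P z)" if "continuous_on {0..T} z" for z
    unfolding P_def
    by (intro continuous_intros indefinite_integral_continuous_1 integrable_continuous_real cont that)
  have bound: "\<bar>P y t - P z t\<bar> \<le> M / 2 * exp (l * t)"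
    if "continuous_on {0..T} y" "continuous_on {0..T} z" "t \<in> {0..T}" "0 \<le> M"
      "\<And>s. s \<in> {0..T} \<Longrightarrow> \<bar>y s - z s\<bar> \<le> M * exp (l * s)" for y z t M
  proof -
    have "\<bar>P y t - P z t\<bar> \<le> L / l * M * exp (l * t)"
      using weighted_integral_bound[OF l(1) that(4,1-3,5)]
      by (simp add: P_def)
    also have "\<dots> \<le> 1 / 2 * M * exp (l * t)"
      using l(2) \<open>0 \<le> M\<close> by (intro mult_right_mono) auto
    finally show ?thesis by simp
  qed
  have clamp: "clamp 0 T x \<in> {0..T}" for x :: real
    using clamp_in_interval[of 0 T x] T by simp
  \<comment> \<open>Elements of this complete space live on the whole line, so the function on
    \<open>{0..T}\<close> is extended by its boundary values by means of
    \<open>clamp\<close>.\<close>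
  have "\<exists>v :: real \<Rightarrow>\<^sub>C real. \<forall>x. v x = exp (- l * clamp 0 T x) * P (Y u) (clamp 0 T x)" for u
  proof -
    have "continuous_on (cbox 0 T) (\<lambda>t. exp (- l * t) * P (Y u) t)"
      by (auto intro!: continuous_intros P Y)
    from continuous_on_cbox_bcontfunE[OF this] show ?thesis by metis
  qed
  then obtain \<Phi> :: "(real \<Rightarrow>\<^sub>C real) \<Rightarrow> (real \<Rightarrow>\<^sub>C real)" where
    \<Phi>: "\<And>u x. \<Phi> u x = exp (- l * clamp 0 T x) * P (Y u) (clamp 0 T x)" by metis
  have "dist (\<Phi> u) (\<Phi> v) \<le> 1 / 2 * dist u v" for u v
  proof (rule dist_bound)
    fix x
    define t where "t = clamp 0 T x"
    have "\<bar>Y u s - Y v s\<bar> \<le> dist u v * exp (l * s)" for s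
    proof -
      have "\<bar>Y u s - Y v s\<bar> = dist (u s) (v s) * exp (l * s)"
        by (simp add: Y_def dist_real_def abs_mult flip: right_diff_distrib)
      also have "\<dots> \<le> dist u v * exp (l * s)"
        by (intro mult_right_mono dist_bounded) auto
      finally show ?thesis .
    qed
    then have *: "\<bar>P (Y u) t - P (Y v) t\<bar> \<le> dist u v / 2 * exp (l * t)"
      by (intro bound Y) (auto simp: t_def clamp[simplified])
    have "dist (\<Phi> u x) (\<Phi> v x) = exp (- l * t) * \<bar>P (Y u) t - P (Y v) t\<bar>"
      by (simp add: \<Phi> t_def dist_real_def abs_mult flip: right_diff_distrib)
    also have "\<dots> \<le> exp (- l * t) * (dist u v / 2 * exp (l * t))"
      by (intro mult_left_mono *) auto
    also have "\<dots> = 1 / 2 * dist u v"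
      by (simp add: exp_minus field_simps)
    finally show "dist (\<Phi> u x) (\<Phi> v x) \<le> 1 / 2 * dist u v" .
  qed
  then obtain u where u: "\<Phi> u = u"
    using banach_fix_type[of "1/2" \<Phi>] by auto
  have fix_eq: "Y u t = P (Y u) t" if t: "t \<in> {0..T}" for t
  proof -
    have "clamp 0 T t = t" using t by (intro clamp_cancel_cbox) auto
    then have "u t = exp (- l * t) * P (Y u) t" using \<Phi>[of u t] u by simp
    then show ?thesis by (simp add: Y_def exp_minus)
  qed
  show thesis
  proof
    show "continuous_on {0..T} (Y u)" by (rule Y)
    show "Y u 0 = y0" using fix_eq[of 0] T by (simp add: P_def)
    show "(Y u has_real_derivative F (Y u) t) (at t within {0..T})" if t: "t \<in> {0..T}" for t
    unfolding has_field_derivative_def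
    proof (rule has_derivative_transform[OF t fix_eq], unfold has_field_derivative_def[symmetric])
      show "(P (Y u) has_real_derivative F (Y u) t) (at t within {0..T})"
        unfolding P_def
        by (auto intro!: derivative_eq_intros integral_has_real_derivative cont Y t)
    qed
    show "z t = Y u t" if z: "continuous_on {0..T} z" "z 0 = y0"
      "\<And>t. t \<in> {0..T} \<Longrightarrow> (z has_real_derivative F z t) (at t within {0..T})"
      and t: "t \<in> {0..T}" for z t
    proof -
      have zP: "z s = P z s" if s: "s \<in> {0..T}" for s
      proof -
        have "(F z has_integral (z s - z 0)) {0..s}"
          by (rule fundamental_theorem_of_calculus)
            (use s in \<open>auto intro!: DERIV_subset[OF z(3)]
              simp flip: has_real_derivative_iff_has_vector_derivative\<close>)
        then show ?thesis by (simp add: P_def has_integral_iff z)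
      qed
      \<comment> \<open>The weighted difference attains its maximum at some \<open>x\<close>. Both
        functions are fixed points of \<open>P\<close>, so the contraction estimate yields
        \<open>d x \<le> d x / 2\<close>, which forces \<open>d\<close> to vanish on the
        interval.\<close>
      define d where "d s = exp (- l * s) * \<bar>z s - Y u s\<bar>" for s
      have "continuous_on {0..T} d"
        unfolding d_def by (intro continuous_intros z Y)
      then obtain x where x: "x \<in> {0..T}" "\<And>s. s \<in> {0..T} \<Longrightarrow> d s \<le> d x"
        using continuous_attains_sup[of "{0..T}" d] T by auto
      have "0 \<le> d x" by (simp add: d_def)
      have "\<bar>P z x - P (Y u) x\<bar> \<le> d x / 2 * exp (l * x)"
      proof (rule bound[OF z(1) Y x(1) \<open>0 \<le> d x\<close>])
        fix s assume "s \<in> {0..T}"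
        from x(2)[OF this] show "\<bar>z s - Y u s\<bar> \<le> d x * exp (l * s)"
          unfolding d_def[of s] by (simp add: exp_minus field_simps)
      qed
      then have "\<bar>z x - Y u x\<bar> \<le> d x / 2 * exp (l * x)"
        using zP[OF x(1)] fix_eq[OF x(1)] by simp
      then have "d x \<le> d x / 2"
        unfolding d_def[of x] by (simp add: exp_minus field_simps)
      with x(2)[OF t] \<open>0 \<le> d x\<close> have "d t \<le> 0" by simp
      then show ?thesis by (simp add: d_def mult_le_0_iff)
    qed
  qed
qed


end

section \<open>Closure properties of the classes of continuously differentiable functions\<close>

lemma Cm_on_SucE:
  assumes "Cm_on (Suc m) S f"
  obtains G where "\<And>x. x \<in> S \<Longrightarrow> (f has_derivative (\<lambda>h. G x \<bullet> h)) (at x within S)"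
    "\<And>b. b \<in> Basis \<Longrightarrow> Cm_on m S (\<lambda>x. G x \<bullet> b)"
proof -
  from assms obtain G where "\<forall>x\<in>S. (f has_derivative (\<lambda>h. G x \<bullet> h)) (at x within S)"
    "\<forall>b\<in>Basis. Cm_on m S (\<lambda>x. G x \<bullet> b)"
    unfolding Cm_on.simps by (elim exE conjE)
  then show thesis using that[of G] by blast
qed

lemma Cm_on_SucI:
  assumes "\<And>x. x \<in> S \<Longrightarrow> (f has_derivative (\<lambda>h. G x \<bullet> h)) (at x within S)"
    "\<And>b. b \<in> Basis \<Longrightarrow> Cm_on m S (\<lambda>x. G x \<bullet> b)"
  shows "Cm_on (Suc m) S f"
  unfolding Cm_on.simps by (intro exI[of _ G] conjI ballI assms)

lemma Cm_on_continuous: "Cm_on m S f \<Longrightarrow> continuous_on S f"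
proof (cases m)
  case (Suc k)
  assume "Cm_on m S f"
  then have "Cm_on (Suc k) S f" using Suc by simp
  then show ?thesis
    by (rule Cm_on_SucE) (rule has_derivative_continuous_on)
qed simp

lemma Cm_on_SucD: "Cm_on (Suc m) S f \<Longrightarrow> Cm_on m S f"
proof (induction m arbitrary: f)
  case 0
  from Cm_on_continuous[OF this] show ?case by simp
next
  case (Suc m)
  from Suc.prems show ?case
    by (rule Cm_on_SucE) (rule Cm_on_SucI, auto intro: Suc.IH)
qed

lemma Cm_on_mono: "k \<le> m \<Longrightarrow> Cm_on m S f \<Longrightarrow> Cm_on k S f"
  by (induction rule: dec_induct) (simp_all only: Cm_on_SucD)

lemma Cm_on_cong:
  assumes "\<And>x. x \<in> S \<Longrightarrow> f x = g x" and "Cm_on m S f"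
  shows "Cm_on m S g"
proof (cases m)
  case 0
  then show ?thesis using assms by (simp cong: continuous_on_cong)
next
  case (Suc k)
  with assms(2) have "Cm_on (Suc k) S f" by simp
  then have "Cm_on (Suc k) S g"
    by (rule Cm_on_SucE)
      (rule Cm_on_SucI, rule has_derivative_transform[where f=f], use assms(1) in auto)
  with Suc show ?thesis by simp
qed

lemma Cm_on_const: "Cm_on m S (\<lambda>_. c)"
proof (induction m arbitrary: c)
  case (Suc m)
  then show ?case by (auto intro!: exI[of _ "\<lambda>_. 0"])
qed simp

lemma Cm_on_add:
  assumes "Cm_on m S f" "Cm_on m S g"
  shows "Cm_on m S (\<lambda>x. f x + g x)"
  using assms
proof (induction m arbitrary: f g)
  case 0
  then show ?case by (auto intro: continuous_intros)
next
  case (Suc m)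
  from Suc.prems(1) obtain F where
    F: "\<And>x. x \<in> S \<Longrightarrow> (f has_derivative (\<lambda>h. F x \<bullet> h)) (at x within S)"
      "\<And>b. b \<in> Basis \<Longrightarrow> Cm_on m S (\<lambda>x. F x \<bullet> b)"
    by (rule Cm_on_SucE) (rule that)
  from Suc.prems(2) obtain G where
    G: "\<And>x. x \<in> S \<Longrightarrow> (g has_derivative (\<lambda>h. G x \<bullet> h)) (at x within S)"
      "\<And>b. b \<in> Basis \<Longrightarrow> Cm_on m S (\<lambda>x. G x \<bullet> b)"
    by (rule Cm_on_SucE) (rule that)
  show ?case unfolding Cm_on.simps
  proof (intro exI[of _ "\<lambda>x. F x + G x"] conjI ballI)
    show "((\<lambda>x. f x + g x) has_derivative (\<lambda>h. (F x + G x) \<bullet> h)) (at x within S)"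
      if "x \<in> S" for x
      by (auto intro!: derivative_eq_intros F G that simp: inner_add_left)
    show "Cm_on m S (\<lambda>x. (F x + G x) \<bullet> b)" if "b \<in> Basis" for b
      using Suc.IH[OF F(2) G(2)] that by (simp add: inner_add_left)
  qed
qed

text \<open>The gradient of the product is \<open>f x *\<^sub>R G x + g x *\<^sub>R F x\<close>. Its
  components pair a factor from the gradient with \<open>f\<close> or \<open>g\<close> itself, which
  first has to be lowered by one class with \<open>Cm_on_SucD\<close> before the induction
  hypothesis applies.\<close>

lemma Cm_on_mult:
  assumes "Cm_on m S f" "Cm_on m S g"
  shows "Cm_on m S (\<lambda>x. f x * g x)"
  using assms
proof (induction m arbitrary: f g)
  case 0
  then show ?case by (auto intro: continuous_intros)
next
  case (Suc m)
  from Suc.prems(1) obtain F where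
    F: "\<And>x. x \<in> S \<Longrightarrow> (f has_derivative (\<lambda>h. F x \<bullet> h)) (at x within S)"
      "\<And>b. b \<in> Basis \<Longrightarrow> Cm_on m S (\<lambda>x. F x \<bullet> b)"
    by (rule Cm_on_SucE) (rule that)
  from Suc.prems(2) obtain G where
    G: "\<And>x. x \<in> S \<Longrightarrow> (g has_derivative (\<lambda>h. G x \<bullet> h)) (at x within S)"
      "\<And>b. b \<in> Basis \<Longrightarrow> Cm_on m S (\<lambda>x. G x \<bullet> b)"
    by (rule Cm_on_SucE) (rule that)
  show ?case unfolding Cm_on.simps
  proof (intro exI[of _ "\<lambda>x. f x *\<^sub>R G x + g x *\<^sub>R F x"] conjI ballI)
    show "((\<lambda>x. f x * g x) has_derivative (\<lambda>h. (f x *\<^sub>R G x + g x *\<^sub>R F x) \<bullet> h)) (at x within S)"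
      if "x \<in> S" for x
      by (auto intro!: derivative_eq_intros F G that simp: inner_add_left)
    show "Cm_on m S (\<lambda>x. (f x *\<^sub>R G x + g x *\<^sub>R F x) \<bullet> b)" if "b \<in> Basis" for b
      using Suc.IH[OF Cm_on_SucD[OF Suc.prems(1)] G(2)]
        Suc.IH[OF Cm_on_SucD[OF Suc.prems(2)] F(2)] that
      by (simp add: inner_add_left Cm_on_add)
  qed
qed

text \<open>By the chain rule the derivative is again a rescaled function times the constant
  \<open>c\<close>, so the induction closes. With \<open>c = \<epsilon>\<close> this handles the
  delay term.\<close>

lemma Cm_on_scale:
  fixes f :: "real \<Rightarrow> real"
  assumes "Cm_on m S f" and "\<And>x. x \<in> S \<Longrightarrow> c * x \<in> S"
  shows "Cm_on m S (\<lambda>x. f (c * x))"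
  using assms(1)
proof (induction m arbitrary: f)
  case 0
  then show ?case using assms(2)
    by (auto intro!: continuous_on_compose2[of S f] continuous_intros)
next
  case (Suc m)
  from Suc.prems obtain f' where
    f': "\<And>x. x \<in> S \<Longrightarrow> (f has_real_derivative f' x) (at x within S)" "Cm_on m S f'"
    unfolding Cm_on_Suc_real by auto
  show ?case unfolding Cm_on_Suc_real
  proof (intro exI[of _ "\<lambda>x. f' (c * x) * c"] conjI ballI)
    show "((\<lambda>x. f (c * x)) has_real_derivative f' (c * x) * c) (at x within S)"
      if x: "x \<in> S" for x
    proof (rule DERIV_image_chain[where f=f and g="(*) c", unfolded o_def])
      show "(f has_real_derivative f' (c * x)) (at (c * x) within (*) c ` S)"
        by (rule DERIV_subset[OF f'(1)]) (use x assms(2) in auto)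
      show "((*) c has_real_derivative c) (at x within S)"
        by (auto intro!: derivative_eq_intros)
    qed
    show "Cm_on m S (\<lambda>x. f' (c * x) * c)"
      by (intro Cm_on_mult Cm_on_const Suc.IH f')
  qed
qed

text \<open>This lets \<open>y\<close> be regarded as a function on the triangle, so that
  \<open>K\<close> times \<open>y\<close> becomes a single function of class C^m there. Its gradient
  is \<open>(0, f' (snd x))\<close>.\<close>

lemma Cm_on_snd:
  fixes f :: "real \<Rightarrow> real" and S :: "(real \<times> real) set"
  assumes "Cm_on m R f" and sub: "snd ` S \<subseteq> R"
  shows "Cm_on m S (\<lambda>x. f (snd x))"
  using assms(1)
proof (induction m arbitrary: f)
  case 0
  then show ?case using sub
    by (auto intro!: continuous_on_compose2[of R f] continuous_intros)
next
  case (Suc m)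
  from Suc.prems obtain f' where
    f': "\<And>x. x \<in> R \<Longrightarrow> (f has_real_derivative f' x) (at x within R)" "Cm_on m R f'"
    unfolding Cm_on_Suc_real by auto
  show ?case unfolding Cm_on.simps
  proof (intro exI[of _ "\<lambda>x. (0, f' (snd x))"] conjI ballI)
    show "((\<lambda>x. f (snd x)) has_derivative (\<lambda>h. (0, f' (snd x)) \<bullet> h)) (at x within S)"
      if x: "x \<in> S" for x
    proof -
      have "(f has_derivative (*) (f' (snd x))) (at (snd x) within snd ` S)"
        by (rule has_derivative_subset[OF _ sub])
          (use f'(1)[of "snd x"] x sub in \<open>auto simp: has_field_derivative_def\<close>)
      from has_derivative_in_compose[OF has_derivative_snd[OF has_derivative_ident] this]
      show ?thesis by (simp add: inner_prod_def mult.commute)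
    qed
    show "Cm_on m S (\<lambda>x. (0, f' (snd x)) \<bullet> b)" if "b \<in> Basis" for b
      using that Suc.IH[OF f'(2)] by (auto simp: Basis_prod_def inner_prod_def Cm_on_const)
  qed
qed

section \<open>Integrals with an integrable weight and a smooth parameter\<close>

text \<open>A continuous function on a compact interval is bounded and measurable, so multiplying by
  it preserves absolute integrability. The weight itself may be unbounded.\<close>

lemma absolutely_integrable_weight_mult:
  fixes w g :: "real \<Rightarrow> real"
  assumes "w absolutely_integrable_on {a..b}" "continuous_on {a..b} g"
  shows "(\<lambda>x. w x * g x) absolutely_integrable_on {a..b}"
proof -
  have "(\<lambda>x. g x * w x) absolutely_integrable_on {a..b}"
  proof (rule absolutely_integrable_bounded_measurable_product_real)
    show "g \<in> borel_measurable (lebesgue_on {a..b})"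
      by (rule continuous_imp_measurable_on_sets_lebesgue) (use assms in auto)
    show "bounded (g ` {a..b})"
      by (intro compact_imp_bounded compact_continuous_image assms) simp
  qed (use assms in auto)
  then show ?thesis by (simp add: mult.commute)
qed

lemma weight_mult_integrable:
  fixes w g :: "real \<Rightarrow> real"
  assumes "w absolutely_integrable_on {a..b}" "continuous_on {a..b} g"
  shows "(\<lambda>x. w x * g x) integrable_on {a..b}"
  using absolutely_integrable_weight_mult[OF assms] by (simp add: absolutely_integrable_on_def)

lemma weighted_integral_abs_le:
  fixes w g :: "real \<Rightarrow> real"
  assumes w: "w absolutely_integrable_on {a..b}" and g: "continuous_on {a..b} g"
    and e: "\<And>x. x \<in> {a..b} \<Longrightarrow> \<bar>g x\<bar> \<le> e"
  shows "\<bar>integral {a..b} (\<lambda>x. w x * g x)\<bar> \<le> e * integral {a..b} (\<lambda>x. \<bar>w x\<bar>)"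
proof -
  have "norm (integral {a..b} (\<lambda>x. w x * g x)) \<le> integral {a..b} (\<lambda>x. e * \<bar>w x\<bar>)"
  proof (rule integral_norm_bound_integral)
    show "(\<lambda>x. w x * g x) integrable_on {a..b}" by (rule weight_mult_integrable[OF w g])
    show "(\<lambda>x. e * \<bar>w x\<bar>) integrable_on {a..b}"
      using integrable_on_mult_right[of "\<lambda>x. \<bar>w x\<bar>" "{a..b}" e] w
      by (simp add: absolutely_integrable_on_def)
    show "norm (w x * g x) \<le> e * \<bar>w x\<bar>" if "x \<in> {a..b}" for x
      using e[OF that] by (simp add: abs_mult mult.commute mult_right_mono)
  qed
  then show ?thesis by simp
qed

text \<open>Uniform continuity on the compact product makes \<open>f s x - f t x\<close> small
  uniformly in \<open>x\<close>, and the weight enters only through the integral of its absolute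
  value.\<close>

lemma continuous_on_weighted_param_integral:
  fixes f :: "'a::metric_space \<Rightarrow> real \<Rightarrow> real"
  assumes S: "compact S" and f: "continuous_on (S \<times> {a..b}) (\<lambda>(t, x). f t x)"
    and w: "w absolutely_integrable_on {a..b}"
  shows "continuous_on S (\<lambda>t. integral {a..b} (\<lambda>x. w x * f t x))"
  unfolding continuous_on_iff
proof (intro ballI allI impI)
  fix t and e :: real assume t: "t \<in> S" and e: "0 < e"
  define W where "W = integral {a..b} (\<lambda>x. \<bar>w x\<bar>)"
  have W: "0 \<le> W" unfolding W_def
    using w by (intro integral_nonneg) (auto simp: absolutely_integrable_on_def)
  \<comment> \<open>The 1 in the denominator covers \<open>W = 0\<close> and makes
    \<open>e' * W\<close> strictly smaller than \<open>e\<close>.\<close>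
  define e' where "e' = e / (W + 1)"
  have e': "0 < e'" "e' * W < e" using W e by (auto simp: e'_def field_simps)
  have cont: "continuous_on {a..b} (f s)" if "s \<in> S" for s
    using that by (intro continuous_on_compose2[OF f, of _ "\<lambda>x. (s, x)", simplified] continuous_intros) auto
  have "uniformly_continuous_on (S \<times> {a..b}) (\<lambda>(t, x). f t x)"
    by (intro compact_uniformly_continuous f compact_Times S) simp
  with e'(1) obtain d where d: "0 < d" "\<And>p q. p \<in> S \<times> {a..b} \<Longrightarrow> q \<in> S \<times> {a..b} \<Longrightarrow>
      dist q p < d \<Longrightarrow> dist (case q of (t, x) \<Rightarrow> f t x) (case p of (t, x) \<Rightarrow> f t x) < e'"
    unfolding uniformly_continuous_on_def by metis
  show "\<exists>d>0. \<forall>s\<in>S. dist s t < d \<longrightarrow>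
    dist (integral {a..b} (\<lambda>x. w x * f s x)) (integral {a..b} (\<lambda>x. w x * f t x)) < e"
  proof (intro exI[of _ d] conjI ballI impI d)
    fix s assume s: "s \<in> S" "dist s t < d"
    have "\<bar>integral {a..b} (\<lambda>x. w x * (f s x - f t x))\<bar> \<le> e' * W" unfolding W_def
    proof (rule weighted_integral_abs_le[OF w])
      show "\<bar>f s x - f t x\<bar> \<le> e'" if "x \<in> {a..b}" for x
        using d(2)[of "(t, x)" "(s, x)"] s t that by (simp add: dist_Pair_Pair dist_real_def)
    qed (intro continuous_intros cont s t)
    moreover have "integral {a..b} (\<lambda>x. w x * (f s x - f t x)) =
        integral {a..b} (\<lambda>x. w x * f s x) - integral {a..b} (\<lambda>x. w x * f t x)"
      unfolding right_diff_distrib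
      by (intro integral_diff weight_mult_integrable w cont s t)
    ultimately show "dist (integral {a..b} (\<lambda>x. w x * f s x)) (integral {a..b} (\<lambda>x. w x * f t x)) < e"
      using e'(2) by (simp add: dist_real_def)
  qed
qed

text \<open>Uniform continuity of \<open>f'\<close> and the mean value inequality bound the
  first-order remainder of \<open>f\<close> by \<open>e' * \<bar>s - t\<bar>\<close> uniformly in
  \<open>x\<close>. Integrated against the weight, this becomes the remainder estimate for the
  integral.\<close>

lemma has_real_derivative_weighted_param_integral:
  fixes f f' :: "real \<Rightarrow> real \<Rightarrow> real"
  assumes S: "compact S" "convex S" and f: "continuous_on (S \<times> {a..b}) (\<lambda>(t, x). f t x)"
    and f': "continuous_on (S \<times> {a..b}) (\<lambda>(t, x). f' t x)"
    and der: "\<And>t x. t \<in> S \<Longrightarrow> x \<in> {a..b} \<Longrightarrow>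
      ((\<lambda>s. f s x) has_real_derivative f' t x) (at t within S)"
    and w: "w absolutely_integrable_on {a..b}" and t: "t \<in> S"
  shows "((\<lambda>t. integral {a..b} (\<lambda>x. w x * f t x)) has_real_derivative
    integral {a..b} (\<lambda>x. w x * f' t x)) (at t within S)"
  unfolding has_field_derivative_def has_derivative_within_alt
proof (intro conjI allI impI bounded_linear_mult_right)
  fix e :: real assume e: "0 < e"
  define W where "W = integral {a..b} (\<lambda>x. \<bar>w x\<bar>)"
  have W: "0 \<le> W" unfolding W_def
    using w by (intro integral_nonneg) (auto simp: absolutely_integrable_on_def)
  define e' where "e' = e / (W + 1)"
  have e': "0 < e'" "e' * W \<le> e" using W e by (auto simp: e'_def field_simps)
  have cont: "continuous_on {a..b} (h s)"
    if "s \<in> S" and h: "continuous_on (S \<times> {a..b}) (\<lambda>(t, x). h t x)" for s and h :: "real \<Rightarrow> real \<Rightarrow> real"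
    using that by (intro continuous_on_compose2[OF h, of _ "\<lambda>x. (s, x)", simplified] continuous_intros) auto
  have "uniformly_continuous_on (S \<times> {a..b}) (\<lambda>(t, x). f' t x)"
    by (intro compact_uniformly_continuous f' compact_Times S) simp
  with e'(1) obtain d where d: "0 < d" "\<And>p q. p \<in> S \<times> {a..b} \<Longrightarrow> q \<in> S \<times> {a..b} \<Longrightarrow>
      dist q p < d \<Longrightarrow> dist (case q of (t, x) \<Rightarrow> f' t x) (case p of (t, x) \<Rightarrow> f' t x) < e'"
    unfolding uniformly_continuous_on_def by metis
  show "\<exists>d>0. \<forall>s\<in>S. norm (s - t) < d \<longrightarrow>
    norm (integral {a..b} (\<lambda>x. w x * f s x) - integral {a..b} (\<lambda>x. w x * f t x) -
      integral {a..b} (\<lambda>x. w x * f' t x) * (s - t)) \<le> e * norm (s - t)"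
  proof (intro exI[of _ d] conjI ballI impI d)
    fix s assume s: "s \<in> S" "norm (s - t) < d"
    have sub: "closed_segment t s \<subseteq> S"
      using closed_segment_subset t s S by blast
    have "\<bar>integral {a..b} (\<lambda>x. w x * (f s x - f t x - f' t x * (s - t)))\<bar> \<le> (e' * \<bar>s - t\<bar>) * W"
      unfolding W_def
    proof (rule weighted_integral_abs_le[OF w])
      show "\<bar>f s x - f t x - f' t x * (s - t)\<bar> \<le> e' * \<bar>s - t\<bar>" if x: "x \<in> {a..b}" for x
      proof -
        \<comment> \<open>Subtracting the linear function \<open>f' t x * r\<close> leaves a
          function of \<open>r\<close> whose derivative \<open>f' r x - f' t x\<close> is at most
          \<open>e'\<close> in absolute value on the segment, which convexity of \<open>S\<close>
          keeps inside \<open>S\<close>.\<close>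
        have "norm ((f s x - f' t x * s) - (f t x - f' t x * t)) \<le> e' * norm (s - t)"
        proof (rule field_differentiable_bound[of "closed_segment t s" "\<lambda>r. f r x - f' t x * r"
              "\<lambda>r. f' r x - f' t x"])
          fix r assume r: "r \<in> closed_segment t s"
          then have "r \<in> S" using sub by blast
          have "((\<lambda>r. f r x) has_real_derivative f' r x) (at r within closed_segment t s)"
            by (rule DERIV_subset[OF der[OF \<open>r \<in> S\<close> x] sub])
          then show "((\<lambda>r. f r x - f' t x * r) has_real_derivative f' r x - f' t x)
              (at r within closed_segment t s)"
            by (auto intro!: derivative_eq_intros)
          have "\<bar>r - t\<bar> < d"
            using segment_bound1[OF r] s(2) by simp
          then show "norm (f' r x - f' t x) \<le> e'"
            using d(2)[of "(t, x)" "(r, x)"] \<open>r \<in> S\<close> t x by (simp add: dist_Pair_Pair dist_real_def)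
        qed auto
        then show ?thesis by (simp add: algebra_simps)
      qed
    qed (intro continuous_intros cont s t f f')
    also have "\<dots> \<le> e * \<bar>s - t\<bar>"
      using mult_right_mono[OF e'(2), of "\<bar>s - t\<bar>"] by (simp add: algebra_simps)
    finally have le: "\<bar>integral {a..b} (\<lambda>x. w x * (f s x - f t x - f' t x * (s - t)))\<bar> \<le> e * \<bar>s - t\<bar>" .
    have "integral {a..b} (\<lambda>x. w x * (f s x - f t x - f' t x * (s - t))) =
        integral {a..b} (\<lambda>x. w x * f s x) - integral {a..b} (\<lambda>x. w x * f t x) -
        integral {a..b} (\<lambda>x. w x * f' t x) * (s - t)"
    proof (rule integral_unique)
      have "((\<lambda>x. w x * f s x - w x * f t x - w x * f' t x * (s - t)) has_integral
          integral {a..b} (\<lambda>x. w x * f s x) - integral {a..b} (\<lambda>x. w x * f t x) -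
          integral {a..b} (\<lambda>x. w x * f' t x) * (s - t)) {a..b}"
        by (intro has_integral_diff has_integral_mult_left integrable_integral
            weight_mult_integrable w cont s t f f')
      then show "((\<lambda>x. w x * (f s x - f t x - f' t x * (s - t))) has_integral
          integral {a..b} (\<lambda>x. w x * f s x) - integral {a..b} (\<lambda>x. w x * f t x) -
          integral {a..b} (\<lambda>x. w x * f' t x) * (s - t)) {a..b}"
        by (simp add: algebra_simps)
    qed
    with le show "norm (integral {a..b} (\<lambda>x. w x * f s x) - integral {a..b} (\<lambda>x. w x * f t x) -
        integral {a..b} (\<lambda>x. w x * f' t x) * (s - t)) \<le> e * norm (s - t)"
      by simp
  qed
qed

section \<open>Weighted integrals along rescaled arguments in the triangle\<close>

lemma scaled_in_closed_triangle:
  assumes "t \<in> {0..T}" "x \<in> {0..1}" "c \<in> {0..1}"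
  shows "(t, c * t * x) \<in> closed_triangle T"
proof -
  have "c * t * x \<le> t"
    using assms mult_left_le_one_le[of t "c * x"] mult_le_one[of c x] by (simp add: ac_simps)
  then show ?thesis using assms by (auto simp: closed_triangle_def)
qed

lemma continuous_on_scaled_closed_triangle:
  fixes \<Phi> :: "real \<times> real \<Rightarrow> real"
  assumes "continuous_on (closed_triangle T) \<Phi>" "c \<in> {0..1}"
  shows "continuous_on ({0..T} \<times> {0..1}) (\<lambda>(t, x). \<Phi> (t, c * t * x))"
proof -
  have "continuous_on ({0..T} \<times> {0..1}) (\<lambda>p. \<Phi> (fst p, c * fst p * snd p))"
    by (intro continuous_on_compose2[OF assms(1)] continuous_intros)
      (use scaled_in_closed_triangle[OF _ _ assms(2)] in auto)
  then show ?thesis by (simp add: case_prod_unfold)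
qed

text \<open>The weight is arbitrary because differentiating in \<open>t\<close> turns \<open>w x\<close> into \<open>c * x * w x\<close>.\<close>

lemma Cm_on_weighted_scaled_integral:
  assumes "Cm_on m (closed_triangle T) \<Phi>" "w absolutely_integrable_on {0..1}" and c: "c \<in> {0..1}"
  shows "Cm_on m {0..T} (\<lambda>t. integral {0..1} (\<lambda>x. w x * \<Phi> (t, c * t * x)))"
  using assms(1,2)
proof (induction m arbitrary: \<Phi> w)
  case 0
  then show ?case
    using continuous_on_weighted_param_integral[OF _ continuous_on_scaled_closed_triangle[OF _ c]]
    by simp
next
  case (Suc m)
  note w = Suc.prems(2)
  from Suc.prems(1) obtain G where
    G: "\<And>p. p \<in> closed_triangle T \<Longrightarrow>
        (\<Phi> has_derivative (\<lambda>h. G p \<bullet> h)) (at p within closed_triangle T)"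
      "\<And>b. b \<in> Basis \<Longrightarrow> Cm_on m (closed_triangle T) (\<lambda>p. G p \<bullet> b)"
    by (rule Cm_on_SucE) (rule that)
  define g1 where "g1 p = G p \<bullet> (1, 0)" for p
  define g2 where "g2 p = G p \<bullet> (0, 1)" for p
  have g: "Cm_on m (closed_triangle T) g1" "Cm_on m (closed_triangle T) g2"
    unfolding g1_def g2_def by (auto intro!: G(2) simp: Basis_prod_def)
  have gc: "continuous_on (closed_triangle T) g1" "continuous_on (closed_triangle T) g2"
    using g by (auto intro: Cm_on_continuous)
  \<comment> \<open>The \<open>t\<close>-derivative of \<open>\<Phi> (t, c * t * x)\<close> by the
    chain rule: \<open>g1\<close> and \<open>g2\<close> are the two partial derivatives, and the
    second argument has inner derivative \<open>c * x\<close>.\<close>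
  define f' where "f' t x = g1 (t, c * t * x) + c * x * g2 (t, c * t * x)" for t x
  have wx: "(\<lambda>x. w x * (c * x)) absolutely_integrable_on {0..1}"
    by (intro absolutely_integrable_weight_mult[OF w] continuous_intros)
  have sec: "continuous_on {0..1} (\<lambda>x. h (t, c * t * x))"
    if "continuous_on (closed_triangle T) h" "t \<in> {0..T}" for h :: "real \<times> real \<Rightarrow> real" and t
    by (intro continuous_on_compose2[OF that(1)] continuous_intros)
      (use scaled_in_closed_triangle[OF that(2) _ c] in auto)
  show ?case unfolding Cm_on_Suc_real
  proof (intro exI[of _ "\<lambda>t. integral {0..1} (\<lambda>x. w x * f' t x)"] conjI ballI)
    show "((\<lambda>t. integral {0..1} (\<lambda>x. w x * \<Phi> (t, c * t * x))) has_real_derivative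
        integral {0..1} (\<lambda>x. w x * f' t x)) (at t within {0..T})" if t: "t \<in> {0..T}" for t
    proof (rule has_real_derivative_weighted_param_integral[OF _ _ _ _ _ w t])
      show "continuous_on ({0..T} \<times> {0..1}) (\<lambda>(t, x). \<Phi> (t, c * t * x))"
        by (intro continuous_on_scaled_closed_triangle c Cm_on_continuous[OF Suc.prems(1)])
      show "continuous_on ({0..T} \<times> {0..1}) (\<lambda>(t, x). f' t x)"
        using continuous_on_scaled_closed_triangle[OF gc(1) c]
          continuous_on_scaled_closed_triangle[OF gc(2) c]
        unfolding f'_def case_prod_unfold by (intro continuous_intros)
      show "((\<lambda>s. \<Phi> (s, c * s * x)) has_real_derivative f' t x) (at t within {0..T})"
        if t: "t \<in> {0..T}" and x: "x \<in> {0..1}" for t x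
      proof -
        let ?k = "\<lambda>s. (s, c * s * x)"
        have k: "(?k has_derivative (\<lambda>h. (h, c * h * x))) (at t within {0..T})"
          by (auto intro!: derivative_eq_intros)
        \<comment> \<open>The curve \<open>?k\<close> stays in the triangle, so the derivative of
          \<open>\<Phi>\<close> within the triangle restricts to the image of the curve, also at
          boundary points.\<close>
        have "(\<Phi> has_derivative (\<lambda>h. G (?k t) \<bullet> h)) (at (?k t) within ?k ` {0..T})"
          by (rule has_derivative_subset[OF G(1)])
            (use scaled_in_closed_triangle[OF _ x c] t in auto)
        from has_derivative_in_compose[OF k this]
        show ?thesis
          unfolding has_field_derivative_def
          by (rule has_derivative_eq_rhs)
            (simp add: fun_eq_iff f'_def g1_def g2_def inner_prod_def algebra_simps)
      qed
    qed auto
    \<comment> \<open>Attaching the factor \<open>c * x\<close> to the weight gives both summands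
      the form of the statement, with \<open>g1\<close> and \<open>g2\<close> in place of
      \<open>\<Phi>\<close>, so the induction hypothesis applies to each.\<close>
    have "Cm_on m {0..T} (\<lambda>t. integral {0..1} (\<lambda>x. w x * g1 (t, c * t * x)) +
        integral {0..1} (\<lambda>x. w x * (c * x) * g2 (t, c * t * x)))"
      by (intro Cm_on_add Suc.IH g w wx)
    then show "Cm_on m {0..T} (\<lambda>t. integral {0..1} (\<lambda>x. w x * f' t x))"
    proof (rule Cm_on_cong[rotated])
      fix t assume t: "t \<in> {0..T}"
      have "integral {0..1} (\<lambda>x. w x * g1 (t, c * t * x)) +
          integral {0..1} (\<lambda>x. w x * (c * x) * g2 (t, c * t * x)) =
          integral {0..1} (\<lambda>x. w x * g1 (t, c * t * x) + w x * (c * x) * g2 (t, c * t * x))"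
        by (intro integral_add[symmetric] weight_mult_integrable w wx sec gc t)
      also have "\<dots> = integral {0..1} (\<lambda>x. w x * f' t x)"
        by (simp add: f'_def algebra_simps)
      finally show "integral {0..1} (\<lambda>x. w x * g1 (t, c * t * x)) +
          integral {0..1} (\<lambda>x. w x * (c * x) * g2 (t, c * t * x)) = integral {0..1} (\<lambda>x. w x * f' t x)" .
    qed
  qed
qed

section \<open>The kernel operators after rescaling\<close>

text \<open>The integrand of the Beta integral for
  \<open>Beta (1 - \<mu>) (\<mu> + \<gamma>)\<close>, which is the constant in the prescribed value
  at \<open>t = 0\<close>.\<close>

definition beta_weight :: "real \<Rightarrow> real \<Rightarrow> real \<Rightarrow> real" where
  "beta_weight \<mu> \<gamma> x = (1 - x) powr (- \<mu>) * x powr (\<mu> + \<gamma> - 1)"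

lemma beta_weight_nonneg: "0 \<le> beta_weight \<mu> \<gamma> x"
  by (simp add: beta_weight_def)

lemma beta_weight_has_integral:
  assumes "\<mu> < 1" "0 < \<mu> + \<gamma>"
  shows "(beta_weight \<mu> \<gamma> has_integral Beta (1 - \<mu>) (\<mu> + \<gamma>)) {0..1}"
  using has_integral_Beta_real[of "\<mu> + \<gamma>" "1 - \<mu>"] assms
  by (simp add: beta_weight_def[abs_def] Beta_commute mult.commute)

lemma beta_weight_absolutely_integrable:
  assumes "\<mu> < 1" "0 < \<mu> + \<gamma>"
  shows "beta_weight \<mu> \<gamma> absolutely_integrable_on {0..1}"
  by (rule nonnegative_absolutely_integrable_1)
    (use beta_weight_has_integral[OF assms] in \<open>auto simp: beta_weight_nonneg has_integral_iff\<close>)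

text \<open>Under \<open>s = r * x\<close> the powers of \<open>r\<close> cancel: the prefactor, the
  differential and the two factors of the kernel contribute the exponents \<open>- \<gamma>\<close>,
  \<open>1\<close>, \<open>- \<mu>\<close> and \<open>\<mu> + \<gamma> - 1\<close>, whose sum is
  0.\<close>

lemma beta_weight_rescale:
  assumes \<mu>: "\<mu> < 1" "0 < \<mu> + \<gamma>" and r: "0 < r" and g: "continuous_on {0..r} g"
  shows "r powr (- \<gamma>) * integral {0..r} (\<lambda>s. (r - s) powr (- \<mu>) * s powr (\<mu> + \<gamma> - 1) * g s) =
    integral {0..1} (\<lambda>x. beta_weight \<mu> \<gamma> x * g (r * x))" (is "_ * integral _ ?h = ?I")
proof -
  have "continuous_on {0..1} (\<lambda>x. g (r * x))"
    by (intro continuous_on_compose2[OF g] continuous_intros) (use r in \<open>auto simp: mult_left_le\<close>)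
  from weight_mult_integrable[OF beta_weight_absolutely_integrable[OF \<mu>] this]
  have "((\<lambda>x. beta_weight \<mu> \<gamma> x * g (r * x)) has_integral ?I) {0..1}"
    by (simp add: has_integral_iff)
  from has_integral_stretch_real[OF this, of "1 / r"] r
  have int: "((\<lambda>s. beta_weight \<mu> \<gamma> (s / r) * g s) has_integral r * ?I) {0..r}"
    by (simp add: image_mult_atLeastAtMost_if' mult.commute)
  \<comment> \<open>Pulling the powers of \<open>r\<close> out of both factors of the weight leaves
    the exponent \<open>\<mu> - (\<mu> + \<gamma> - 1) = 1 - \<gamma>\<close>.\<close>
  have eq: "beta_weight \<mu> \<gamma> (s / r) * g s = r powr (1 - \<gamma>) * ?h s" if s: "s \<in> {0..r}" for s
  proof -
    have "1 - s / r = (r - s) / r" using r by (simp add: field_simps)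
    moreover have "r powr (1 - \<gamma>) = 1 / (r powr (- \<mu>) * r powr (\<mu> + \<gamma> - 1))"
      by (simp add: powr_add[symmetric] powr_minus_divide[symmetric])
    ultimately show ?thesis
      using r s by (simp add: beta_weight_def powr_divide)
  qed
  have "((\<lambda>s. r powr (1 - \<gamma>) * ?h s) has_integral r * ?I) {0..r}"
    by (rule has_integral_eq[OF eq int])
  then have "r powr (1 - \<gamma>) * integral {0..r} ?h = r * ?I"
    by (simp add: has_integral_iff)
  moreover have "r powr (1 - \<gamma>) = r * r powr (- \<gamma>)"
    using r by (simp add: powr_diff powr_minus divide_inverse)
  ultimately show ?thesis using r by simp
qed

text \<open>One operator serves both kernels, with \<open>c = 1\<close> and
  \<open>c = \<epsilon>\<close>. It takes the prescribed value at \<open>t = 0\<close> without a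
  case distinction, since all arguments of \<open>K\<close> and \<open>y\<close> are then 0.\<close>

definition scaled_volterra ::
  "real \<Rightarrow> real \<Rightarrow> real \<Rightarrow> (real \<times> real \<Rightarrow> real) \<Rightarrow> (real \<Rightarrow> real) \<Rightarrow> real \<Rightarrow> real" where
  "scaled_volterra c \<mu> \<gamma> K y t =
    integral {0..1} (\<lambda>x. beta_weight \<mu> \<gamma> x * (K (t, c * t * x) * y (c * t * x)))"

lemma snd_closed_triangle_subset: "snd ` closed_triangle T \<subseteq> {0..T}"
  by (auto simp: closed_triangle_def)

text \<open>The product of \<open>K\<close> with \<open>y\<close>, lifted to the triangle through
  \<open>snd\<close>, is of class C^m there, which is what differentiation under the weighted
  integral asks for.\<close>

lemma Cm_on_scaled_volterra:
  assumes "\<mu> < 1" "0 < \<mu> + \<gamma>" "c \<in> {0..1}"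
    and "Cm_on m (closed_triangle T) K" "Cm_on m {0..T} y"
  shows "Cm_on m {0..T} (scaled_volterra c \<mu> \<gamma> K y)"
  using Cm_on_weighted_scaled_integral[OF Cm_on_mult[OF assms(4) Cm_on_snd[OF assms(5)
        snd_closed_triangle_subset]] beta_weight_absolutely_integrable[OF assms(1,2)] assms(3)]
  by (simp add: scaled_volterra_def[abs_def])

lemma continuous_on_scaled_volterra_integrand:
  fixes K :: "real \<times> real \<Rightarrow> real" and y :: "real \<Rightarrow> real"
  assumes "continuous_on (closed_triangle T) K" "continuous_on {0..T} y"
    and t: "t \<in> {0..T}" and c: "c \<in> {0..1}"
  shows "continuous_on {0..1} (\<lambda>x. K (t, c * t * x) * y (c * t * x))"
proof -
  have *: "(t, c * t * x) \<in> closed_triangle T" if "x \<in> {0..1}" for x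
    using scaled_in_closed_triangle[OF t that c] .
  show ?thesis
    by (intro continuous_on_mult continuous_on_compose2[OF assms(1)]
        continuous_on_compose2[OF assms(2)] continuous_intros)
      (use * in \<open>force simp: closed_triangle_def\<close>)+
qed

text \<open>The points \<open>c * t * x\<close> lie in \<open>{0..t}\<close>, which gives causality.
  The constant is the bound on the kernel times the integral of the nonnegative weight.\<close>

lemma scaled_volterra_lipschitz:
  assumes \<mu>: "\<mu> < 1" "0 < \<mu> + \<gamma>" and c: "c \<in> {0..1}" and t: "t \<in> {0..T}"
    and K: "continuous_on (closed_triangle T) K"
    and y: "continuous_on {0..T} y" and z: "continuous_on {0..T} z"
    and k: "\<And>p. p \<in> closed_triangle T \<Longrightarrow> \<bar>K p\<bar> \<le> k"
    and M: "\<And>s. s \<in> {0..t} \<Longrightarrow> \<bar>y s - z s\<bar> \<le> M"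
  shows "\<bar>scaled_volterra c \<mu> \<gamma> K y t - scaled_volterra c \<mu> \<gamma> K z t\<bar>
    \<le> k * Beta (1 - \<mu>) (\<mu> + \<gamma>) * M"
proof -
  note w = beta_weight_absolutely_integrable[OF \<mu>]
  let ?d = "\<lambda>x. K (t, c * t * x) * y (c * t * x) - K (t, c * t * x) * z (c * t * x)"
  have diff: "scaled_volterra c \<mu> \<gamma> K y t - scaled_volterra c \<mu> \<gamma> K z t =
      integral {0..1} (\<lambda>x. beta_weight \<mu> \<gamma> x * ?d x)"
    unfolding scaled_volterra_def right_diff_distrib
    by (intro integral_diff[symmetric] weight_mult_integrable w
        continuous_on_scaled_volterra_integrand[where T=T] K y z t c)
  have "\<bar>integral {0..1} (\<lambda>x. beta_weight \<mu> \<gamma> x * ?d x)\<bar> \<le>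
      k * M * integral {0..1} (\<lambda>x. \<bar>beta_weight \<mu> \<gamma> x\<bar>)"
  proof (rule weighted_integral_abs_le[OF w])
    show "continuous_on {0..1} ?d"
      by (intro continuous_on_diff continuous_on_scaled_volterra_integrand[where T=T] K y z t c)
    fix x :: real assume "x \<in> {0..1}"
    from scaled_in_closed_triangle[OF t this c]
    have *: "(t, c * t * x) \<in> closed_triangle T" .
    then have "c * t * x \<in> {0..t}" by (auto simp: closed_triangle_def)
    then show "\<bar>?d x\<bar> \<le> k * M"
      unfolding right_diff_distrib[symmetric] abs_mult
      by (intro mult_mono k[OF *] M) (use k[OF *] in auto)
  qed
  also have "integral {0..1} (\<lambda>x. \<bar>beta_weight \<mu> \<gamma> x\<bar>) = Beta (1 - \<mu>) (\<mu> + \<gamma>)"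
    using beta_weight_has_integral[OF \<mu>] by (simp add: beta_weight_nonneg has_integral_iff)
  finally show ?thesis by (simp add: diff mult.commute mult.left_commute)
qed

lemma scaled_volterra_0:
  assumes "\<mu> < 1" "0 < \<mu> + \<gamma>"
  shows "scaled_volterra c \<mu> \<gamma> K y 0 = Beta (1 - \<mu>) (\<mu> + \<gamma>) * K (0, 0) * y 0"
  using beta_weight_has_integral[OF assms] by (simp add: scaled_volterra_def has_integral_iff)

text \<open>This is \<open>beta_weight_rescale\<close> with \<open>r = c * t\<close>, applied to
  \<open>K (t, s) * y s\<close> as a function of \<open>s\<close> with \<open>t\<close>
  fixed.\<close>

lemma scaled_volterra_eq:
  assumes \<mu>: "\<mu> < 1" "0 < \<mu> + \<gamma>" and c: "0 < c" "c \<le> 1" and t: "t \<in> {0<..T}"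
    and K: "continuous_on (closed_triangle T) K" and y: "continuous_on {0..T} y"
  shows "(c * t) powr (- \<gamma>) * integral {0..c * t}
      (\<lambda>s. (c * t - s) powr (- \<mu>) * s powr (\<mu> + \<gamma> - 1) * K (t, s) * y s) =
    scaled_volterra c \<mu> \<gamma> K y t"
proof -
  have "continuous_on {0..r} (\<lambda>s. K (t, s) * y s)" if "r \<le> t" for r
    by (intro continuous_on_mult continuous_on_compose2[OF K] continuous_on_subset[OF y]
        continuous_intros) (use t that in \<open>auto simp: closed_triangle_def\<close>)
  moreover have "c * t \<le> t" using c t by (simp add: mult_left_le_one_le)
  ultimately have "continuous_on {0..c * t} (\<lambda>s. K (t, s) * y s)" .
  from beta_weight_rescale[OF \<mu> _ this] c t show ?thesis
    by (simp add: scaled_volterra_def mult.assoc)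
qed

section \<open>Existence, uniqueness and regularity for the initial value problem\<close>

theorem theorem1:
  fixes T \<epsilon> \<mu> \<gamma> y0 :: real
    and p1 q1 g1 :: "real \<Rightarrow> real"
    and K1 K2 :: "real \<times> real \<Rightarrow> real"
  assumes "T > 0" and "0 < \<epsilon>" and "\<epsilon> < 1" and "0 \<le> \<mu>" and "\<mu> < 1"
    and "\<gamma> > 0" and "\<mu> + \<gamma> \<ge> 1"
    and "continuous_on (closed_triangle T) K1" and "continuous_on (closed_triangle T) K2"
    and "continuous_on {0..T} p1" and "continuous_on {0..T} q1" and "continuous_on {0..T} g1"
  shows "\<exists>y. Cm_on 1 {0..T} y \<and> solves_ivp T \<epsilon> \<mu> \<gamma> p1 q1 g1 K1 K2 y0 y \<and>
    (\<forall>z. Cm_on 1 {0..T} z \<and> solves_ivp T \<epsilon> \<mu> \<gamma> p1 q1 g1 K1 K2 y0 z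
       \<longrightarrow> (\<forall>t\<in>{0..T}. z t = y t)) \<and>
    (\<forall>m::nat. m \<ge> 1 \<and> Cm_on m {0..T} p1 \<and> Cm_on m {0..T} q1 \<and> Cm_on m {0..T} g1 \<and>
       Cm_on m (closed_triangle T) K1 \<and> Cm_on m (closed_triangle T) K2
       \<longrightarrow> Cm_on (m + 1) {0..T} y)"
proof -
  have \<mu>: "\<mu> < 1" "0 < \<mu> + \<gamma>" using assms by auto
  have c: "1 \<in> {0..1::real}" "\<epsilon> \<in> {0..1}" using assms by auto
  have scale: "\<epsilon> * t \<in> {0..T}" "\<epsilon> * t \<in> {0..t}" if "t \<in> {0..T}" for t
  proof -
    have "\<epsilon> * t \<le> t" using that assms(2,3) by (simp add: mult_left_le_one_le)
    then show "\<epsilon> * t \<in> {0..T}" "\<epsilon> * t \<in> {0..t}" using that assms(2) by auto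
  qed
  define F where "F y t = p1 t * y t + q1 t * y (\<epsilon> * t) + g1 t
    + scaled_volterra 1 \<mu> \<gamma> K1 y t + scaled_volterra \<epsilon> \<mu> \<gamma> K2 y t" for y :: "real \<Rightarrow> real" and t
  have F_Cm: "Cm_on m {0..T} (F y)"
    if "Cm_on m {0..T} p1" "Cm_on m {0..T} q1" "Cm_on m {0..T} g1"
      "Cm_on m (closed_triangle T) K1" "Cm_on m (closed_triangle T) K2" "Cm_on m {0..T} y" for m and y :: "real \<Rightarrow> real"
    unfolding F_def
    by (intro Cm_on_add Cm_on_mult Cm_on_scale that scale(1) Cm_on_scaled_volterra \<mu> c)
  have F_cont: "continuous_on {0..T} (F y)" if "continuous_on {0..T} y" for y :: "real \<Rightarrow> real"
    using F_Cm[of 0 y] assms that by simp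
  \<comment> \<open>The rescaled right-hand side agrees with the original one for continuous
    \<open>y\<close>, because the substitution was established for continuous integrands apart from
    the weight. Competing solutions are of class C^1, hence continuous.\<close>
  have solves_iff: "solves_ivp T \<epsilon> \<mu> \<gamma> p1 q1 g1 K1 K2 y0 y \<longleftrightarrow> y 0 = y0 \<and>
      (\<forall>t\<in>{0..T}. (y has_real_derivative F y t) (at t within {0..T}))"
    if y: "continuous_on {0..T} y" for y :: "real \<Rightarrow> real"
  proof -
    have "volterra_op \<mu> \<gamma> K1 y t = scaled_volterra 1 \<mu> \<gamma> K1 y t"
      "delay_volterra_op \<epsilon> \<mu> \<gamma> K2 y t = scaled_volterra \<epsilon> \<mu> \<gamma> K2 y t" if t: "t \<in> {0..T}" for t
      using scaled_volterra_eq[OF \<mu>, of 1 t T K1 y] scaled_volterra_eq[OF \<mu>, of \<epsilon> t T K2 y] assms y t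
      by (auto simp: volterra_op_def delay_volterra_op_def scaled_volterra_0[OF \<mu>])
    then show ?thesis by (simp add: solves_ivp_def F_def)
  qed
  have "compact (closed_triangle T)"
  proof -
    have "closed (closed_triangle T)"
      unfolding closed_triangle_def case_prod_unfold
      by (intro closed_Collect_conj closed_Collect_le continuous_intros)
    moreover have "closed_triangle T \<subseteq> {0..T} \<times> {0..T}"
      by (auto simp: closed_triangle_def)
    then have "bounded (closed_triangle T)"
      by (rule bounded_subset[rotated]) (intro bounded_Times; simp)
    ultimately show ?thesis by (simp add: compact_eq_bounded_closed)
  qed
  then have "\<exists>k. \<forall>p\<in>closed_triangle T. \<bar>K p\<bar> \<le> k"
    if "continuous_on (closed_triangle T) K" for K :: "real \<times> real \<Rightarrow> real"
    using compact_imp_bounded[OF compact_continuous_image[OF that]] by (auto simp: bounded_iff)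
  then obtain k1 k2 where
    k: "\<And>p. p \<in> closed_triangle T \<Longrightarrow> \<bar>K1 p\<bar> \<le> k1" "\<And>p. p \<in> closed_triangle T \<Longrightarrow> \<bar>K2 p\<bar> \<le> k2"
    using assms(8,9) by metis
  have "\<exists>k. \<forall>t\<in>{0..T}. \<bar>p t\<bar> \<le> k" if "continuous_on {0..T} p" for p :: "real \<Rightarrow> real"
    using compact_imp_bounded[OF compact_continuous_image[OF that]] by (auto simp: bounded_iff)
  then obtain P Q where
    PQ: "\<And>t. t \<in> {0..T} \<Longrightarrow> \<bar>p1 t\<bar> \<le> P" "\<And>t. t \<in> {0..T} \<Longrightarrow> \<bar>q1 t\<bar> \<le> Q"
    using assms(10,11) by metis
  define B where "B = Beta (1 - \<mu>) (\<mu> + \<gamma>)"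
  \<comment> \<open>One summand for each term of \<open>F\<close> that involves \<open>y\<close>:
    the bounds on \<open>p1\<close> and \<open>q1\<close>, and for each kernel its bound times the
    integral \<open>B\<close> of the weight.\<close>
  define L where "L = P + Q + k1 * B + k2 * B"
  interpret causal_lipschitz T L F
  proof
    fix y z :: "real \<Rightarrow> real" and t M
    assume y: "continuous_on {0..T} y" and z: "continuous_on {0..T} z" and t: "t \<in> {0..T}"
      and M: "\<And>s. s \<in> {0..t} \<Longrightarrow> \<bar>y s - z s\<bar> \<le> M"
    have "F y t - F z t = p1 t * (y t - z t) + q1 t * (y (\<epsilon> * t) - z (\<epsilon> * t))
        + (scaled_volterra 1 \<mu> \<gamma> K1 y t - scaled_volterra 1 \<mu> \<gamma> K1 z t)
        + (scaled_volterra \<epsilon> \<mu> \<gamma> K2 y t - scaled_volterra \<epsilon> \<mu> \<gamma> K2 z t)"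
      by (simp add: F_def algebra_simps)
    moreover have "\<bar>p1 t * (y t - z t)\<bar> \<le> P * M"
      unfolding abs_mult by (intro mult_mono PQ t M) (use PQ[OF t] t in auto)
    moreover have "\<bar>q1 t * (y (\<epsilon> * t) - z (\<epsilon> * t))\<bar> \<le> Q * M"
      unfolding abs_mult by (intro mult_mono PQ t M scale) (use PQ[OF t] t in auto)
    moreover have "\<bar>scaled_volterra 1 \<mu> \<gamma> K1 y t - scaled_volterra 1 \<mu> \<gamma> K1 z t\<bar> \<le> k1 * B * M"
      unfolding B_def by (rule scaled_volterra_lipschitz[OF \<mu> c(1) t assms(8) y z k(1) M])
    moreover have "\<bar>scaled_volterra \<epsilon> \<mu> \<gamma> K2 y t - scaled_volterra \<epsilon> \<mu> \<gamma> K2 z t\<bar> \<le> k2 * B * M"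
      unfolding B_def by (rule scaled_volterra_lipschitz[OF \<mu> c(2) t assms(9) y z k(2) M])
    ultimately show "\<bar>F y t - F z t\<bar> \<le> L * M"
      unfolding L_def distrib_right by linarith
  next
    have "0 \<le> B"
      using has_integral_nonneg[OF beta_weight_has_integral[OF \<mu>]] by (simp add: B_def beta_weight_nonneg)
    moreover have "0 \<le> P" "0 \<le> Q" using PQ[of 0] assms(1) by auto
    moreover have "0 \<le> k1" "0 \<le> k2" using k[of "(0, 0)"] assms(1) by (auto simp: closed_triangle_def)
    ultimately show "0 \<le> L" by (simp add: L_def)
  qed (rule F_cont)
  obtain y :: "real \<Rightarrow> real" where y: "continuous_on {0..T} y" "y 0 = y0"
    "\<And>t. t \<in> {0..T} \<Longrightarrow> (y has_real_derivative F y t) (at t within {0..T})"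
    and uniq: "\<And>z t. \<lbrakk>continuous_on {0..T} z; z 0 = y0;
      \<And>t. t \<in> {0..T} \<Longrightarrow> (z has_real_derivative F z t) (at t within {0..T}); t \<in> {0..T}\<rbrakk>
      \<Longrightarrow> z t = y t"
    using unique_solution[OF assms(1)] by blast
  \<comment> \<open>Since \<open>F y\<close> is the derivative of \<open>y\<close>, each class
    reached by \<open>F y\<close> gives \<open>y\<close> one class more.\<close>
  have up: "Cm_on (Suc m) {0..T} y" if "Cm_on m {0..T} (F y)" for m
    unfolding Cm_on_Suc_real using y(3) that by blast
  have reg: "Cm_on (Suc m) {0..T} y"
    if m: "Cm_on m {0..T} p1" "Cm_on m {0..T} q1" "Cm_on m {0..T} g1"
      "Cm_on m (closed_triangle T) K1" "Cm_on m (closed_triangle T) K2" for m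
  proof -
    \<comment> \<open>Bootstrapping from continuity: for \<open>k \<le> m\<close> the data are of
      class C^k, so \<open>F y\<close> inherits this class from \<open>y\<close>, and
      \<open>up\<close> raises \<open>y\<close> to the class \<open>Suc k\<close>. The last lift is
      from \<open>m\<close> to \<open>Suc m\<close>.\<close>
    have "Cm_on k {0..T} y" if "k \<le> Suc m" for k
      using that
    proof (induction k)
      case 0
      then show ?case using y(1) by simp
    next
      case (Suc k)
      then show ?case by (intro up F_Cm m[THEN Cm_on_mono[rotated]]) auto
    qed
    then show ?thesis by blast
  qed
  have C1: "Cm_on 1 {0..T} y"
    unfolding One_nat_def by (rule up) (simp add: F_cont y(1))
  have sol: "solves_ivp T \<epsilon> \<mu> \<gamma> p1 q1 g1 K1 K2 y0 y" using solves_iff y by blast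
  have un: "z t = y t"
    if "Cm_on 1 {0..T} z" "solves_ivp T \<epsilon> \<mu> \<gamma> p1 q1 g1 K1 K2 y0 z" "t \<in> {0..T}" for z t
  proof -
    note z = Cm_on_continuous[OF that(1)]
    from that(2) have "z 0 = y0"
      "\<forall>t\<in>{0..T}. (z has_real_derivative F z t) (at t within {0..T})"
      by (simp_all add: solves_iff[OF z])
    then show ?thesis by (intro uniq z that(3)) simp_all
  qed
  show ?thesis
  proof (intro exI[of _ y] conjI allI impI ballI)
    show "z t = y t"
      if "Cm_on 1 {0..T} z \<and> solves_ivp T \<epsilon> \<mu> \<gamma> p1 q1 g1 K1 K2 y0 z" "t \<in> {0..T}" for z t
      using that un by blast
    show "Cm_on (m + 1) {0..T} y"
      if "m \<ge> 1 \<and> Cm_on m {0..T} p1 \<and> Cm_on m {0..T} q1 \<and> Cm_on m {0..T} g1 \<and>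
        Cm_on m (closed_triangle T) K1 \<and> Cm_on m (closed_triangle T) K2" for m
      unfolding Suc_eq_plus1[symmetric] using that reg by blast
  qed (fact C1 sol)+
qed

end
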